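(* Let $X$ be a compact metrizable Hausdorff space and $\varphi:X\to X$ a continuous, locally injective and surjective map. The endomorphism $\widehat\varphi:C^*_r(R_\varphi)\to C^*_r(R_\varphi)$ is a full corner endomorphism in the sense that the projection $\widehat\varphi(1)=vv^*$ is full in $C^*_r(R_\varphi)$.
   Context: The groupoids. $\Gamma_\varphi=\{(x,k,y)\in X\times\mathbb Z\times X:\ \exists a,b\in\mathbb N,\ k=a-b,\ \varphi^a(x)=\varphi^b(y)\}$ with product $(x,k,y)(y,k',y')=(x,k+k',y')$ and inverse $(x,k,y)^{-1}=(y,-k,x)$; here $\mathbb N=\{0,1,2,\dots\}$. For $k\in\mathbb Z$, $n\in\mathbb N$, $n+k\ge0$, let $\Gamma_\varphi(k,n)=\{(x,k,y):\varphi^{k+i}(x)=\varphi^i(y)\ \forall i\ge n\}$ with the relative topology from $X\times\mathbb Z\times X$; it is open in $\Gamma_\varphi(k,n+1)$. $\Gamma_\varphi(k)=\bigcup_n\Gamma_\varphi(k,n)$ has the inductive limit topology and $\Gamma_\varphi=\bigsqcup_{k}\Gamma_\varphi(k)$ has the topology in which each $\Gamma_\varphi(k)$ is open and closed. This is a locally compact Hausdorff groupoid with locally injective range map, with unit space $X$ via $x\mapsto(x,0,x)$. $R_\varphi$ is the open subgroupoid $\Gamma_\varphi(0)$, identified with $\{(x,y)\in X\times X:\varphi^i(x)=\varphi^i(y)\text{ for some }i\in\mathbb N\}$, and $R(\varphi^n)=\{(x,y):\varphi^n(x)=\varphi^n(y)\}$ (topology from $X\times X$) is identified with the open subgroupoid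 $\Gamma_\varphi(0,n)$, so $R_\varphi=\bigcup_nR(\varphi^n)$. The $C^*$-algebras. For a locally compact Hausdorff groupoid $G$ with locally injective range map $r$ (source map $s$, unit space $G^0$), $B_c(G)$ is the $*$-algebra of bounded compactly supported functions $G\to\mathbb C$ with product $(f\star g)(\gamma)=\sum_{\gamma_1\gamma_2=\gamma}f(\gamma_1)g(\gamma_2)$ and involution $f^*(\gamma)=\overline{f(\gamma^{-1})}$. For $x\in G^0$, $\pi_x$ is the representation on $l^2(s^{-1}(x))$ with $(\pi_x(f)\psi)(\gamma)=\sum_{\gamma_1\gamma_2=\gamma}f(\gamma_1)\psi(\gamma_2)$. $B^*_r(G)$ is the completion of $B_c(G)$ in $\|f\|=\sup_x\|\pi_x(f)\|$, and $C^*_r(G)$ is the $C^*$-subalgebra of $B^*_r(G)$ generated by the continuous compactly supported functions $C_c(G)$. The inclusion of $B_c(G)$ into the bounded functions vanishing at infinity extends to an injective norm-decreasing map on $B^*_r(G)$, so elements of $B^*_r(G)$ are regarded as functions on $G$. Extension of functions by zero yields $C^*$-inclusions $C^*_r(R(\varphi^n))\subseteq C^*_r(R(\varphi^{n+1}))\subseteq C^*_r(R_\varphi)\subseteq C^*_r(\Gamma_\varphi)$, and $\bigcup_nC^*_r(R(\varphi^n))$ is dense in $C^*_r(R_\varphi)$. The endomorphism and isometry. Let $m(x)=\#\{y\in X:\varphi(y)=\varphi(x)\}$. $\widehat\varphi$ is the $*$-endomorphism of $C^*_r(R_\varphi)$ which for each $k\ge1$ maps $C^*_r(R(\varphi^k))$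 into $C^*_r(R(\varphi^{k+1}))$ by $\widehat\varphi(f)(x,y)=m(x)^{-1/2}m(y)^{-1/2}f(\varphi(x),\varphi(y))$. The isometry $v\in C^*_r(\Gamma_\varphi)$ is the function with $v(x,k,y)=m(x)^{-1/2}$ if $k=1$ and $y=\varphi(x)$, and $v(x,k,y)=0$ otherwise; it satisfies $vav^*=\widehat\varphi(a)$ for $a\in C^*_r(R_\varphi)$. A projection in a $C^*$-algebra is full if the closed two-sided ideal it generates is the whole algebra. *)

theory Defs
  imports "HOL-Analysis.Analysis"
begin

section \<open>Topological groupoids and their function algebras\<close>

text \<open>The arrows are the points of the topology. Product and inverse are total functions of which
  only the values on composable pairs of arrows, respectively on arrows, are used. A unit is
  identified with its identity arrow, so \<open>G\<^sup>0\<close> is a set of arrows.\<close>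

record 'g top_groupoid =
  gtop :: "'g topology"
  gmult :: "'g \<Rightarrow> 'g \<Rightarrow> 'g"
  ginv :: "'g \<Rightarrow> 'g"

definition arrows :: "'g top_groupoid \<Rightarrow> 'g set" where
  "arrows G = topspace (gtop G)"

definition src :: "'g top_groupoid \<Rightarrow> 'g \<Rightarrow> 'g" where
  "src G \<gamma> = gmult G (ginv G \<gamma>) \<gamma>"

definition rng :: "'g top_groupoid \<Rightarrow> 'g \<Rightarrow> 'g" where
  "rng G \<gamma> = gmult G \<gamma> (ginv G \<gamma>)"

definition units :: "'g top_groupoid \<Rightarrow> 'g set" where
  "units G = src G ` arrows G"

definition src_fibre :: "'g top_groupoid \<Rightarrow> 'g \<Rightarrow> 'g set" where
  "src_fibre G x = {\<gamma> \<in> arrows G. src G \<gamma> = x}"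

definition factorizations :: "'g top_groupoid \<Rightarrow> 'g \<Rightarrow> ('g \<times> 'g) set" where
  "factorizations G \<gamma> =
     {(\<gamma>1, \<gamma>2). \<gamma>1 \<in> arrows G \<and> \<gamma>2 \<in> arrows G \<and> src G \<gamma>1 = rng G \<gamma>2 \<and> gmult G \<gamma>1 \<gamma>2 = \<gamma>}"

text \<open>A function on \<open>G\<close> is represented by its extension by zero to the whole type. In this way the
  inclusions of function algebras given by extension by zero from an open subgroupoid become
  inclusions of sets.

  The sum in the product is finite for bounded functions of compact support. It is written as an
  unconditional infinite sum so that the same formula is the product of two elements of
  \<open>B\<^sup>*\<^sub>r(G)\<close>, regarded as functions (rows and columns of such elements are square summable).\<close>

definition conv :: "'g top_groupoid \<Rightarrow> ('g \<Rightarrow> complex) \<Rightarrow> ('g \<Rightarrow> complex) \<Rightarrow> 'g \<Rightarrow> complex" where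
  "conv G f g \<gamma> = (\<Sum>\<^sub>\<infinity>(\<gamma>1, \<gamma>2)\<in>factorizations G \<gamma>. f \<gamma>1 * g \<gamma>2)"

definition adj :: "'g top_groupoid \<Rightarrow> ('g \<Rightarrow> complex) \<Rightarrow> 'g \<Rightarrow> complex" where
  "adj G f \<gamma> = (if \<gamma> \<in> arrows G then cnj (f (ginv G \<gamma>)) else 0)"

definition compactly_supported :: "'g top_groupoid \<Rightarrow> ('g \<Rightarrow> complex) \<Rightarrow> bool" where
  "compactly_supported G f \<longleftrightarrow>
     (\<forall>\<gamma>. \<gamma> \<notin> arrows G \<longrightarrow> f \<gamma> = 0) \<and>
     compactin (gtop G) (gtop G closure_of {\<gamma> \<in> arrows G. f \<gamma> \<noteq> 0})"

definition B_c :: "'g top_groupoid \<Rightarrow> ('g \<Rightarrow> complex) set" where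
  "B_c G = {f. compactly_supported G f \<and> bounded (f ` arrows G)}"

definition C_c :: "'g top_groupoid \<Rightarrow> ('g \<Rightarrow> complex) set" where
  "C_c G = {f. compactly_supported G f \<and> continuous_map (gtop G) euclidean f}"


section \<open>The reduced norm and the algebras \<open>B\<^sup>*\<^sub>r(G)\<close> and \<open>C\<^sup>*\<^sub>r(G)\<close>\<close>

definition l2_space :: "'g set \<Rightarrow> ('g \<Rightarrow> complex) set" where
  "l2_space S = {\<psi>. (\<forall>\<gamma>. \<gamma> \<notin> S \<longrightarrow> \<psi> \<gamma> = 0) \<and> (\<lambda>\<gamma>. (cmod (\<psi> \<gamma>))\<^sup>2) summable_on S}"

definition l2_norm :: "'g set \<Rightarrow> ('g \<Rightarrow> complex) \<Rightarrow> real" where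
  "l2_norm S \<psi> = sqrt (\<Sum>\<^sub>\<infinity>\<gamma>\<in>S. (cmod (\<psi> \<gamma>))\<^sup>2)"

definition reg_rep ::
  "'g top_groupoid \<Rightarrow> 'g \<Rightarrow> ('g \<Rightarrow> complex) \<Rightarrow> ('g \<Rightarrow> complex) \<Rightarrow> 'g \<Rightarrow> complex" where
  "reg_rep G x f \<psi> \<gamma> =
     (if \<gamma> \<in> src_fibre G x
      then \<Sum>\<^sub>\<infinity>(\<gamma>1, \<gamma>2)\<in>factorizations G \<gamma>. f \<gamma>1 * \<psi> \<gamma>2 else 0)"

definition reg_rep_norm :: "'g top_groupoid \<Rightarrow> 'g \<Rightarrow> ('g \<Rightarrow> complex) \<Rightarrow> real" where
  "reg_rep_norm G x f =
     (SUP \<psi>\<in>{\<psi> \<in> l2_space (src_fibre G x). l2_norm (src_fibre G x) \<psi> \<le> 1}.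
        l2_norm (src_fibre G x) (reg_rep G x f \<psi>))"

text \<open>On \<open>B_c(G)\<close> all the suprema are finite when the range map is locally injective. For an
  element \<open>F\<close> of \<open>B\<^sup>*\<^sub>r(G)\<close>, regarded as a function, the numbers \<open>F(\<gamma>\<eta>\<^sup>-\<^sup>1)\<close> are the
  matrix entries of the operator which \<open>F\<close> induces on \<open>l\<^sup>2(s\<^sup>-\<^sup>1(x))\<close>, and the same
  expression is the norm of \<open>F\<close> in the completion.\<close>

definition red_norm :: "'g top_groupoid \<Rightarrow> ('g \<Rightarrow> complex) \<Rightarrow> real" where
  "red_norm G f = (SUP x\<in>units G. reg_rep_norm G x f)"

text \<open>The completion of \<open>B_c(G)\<close>, realised as an algebra of functions on \<open>G\<close>: the point of the
  completion given by a Cauchy sequence in \<open>B_c(G)\<close> is regarded as the pointwise limit of that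
  sequence. This is legitimate because the inclusion of \<open>B_c(G)\<close> into the functions on \<open>G\<close>
  decreases norms and extends to an injective map on the completion.\<close>

definition B_star :: "'g top_groupoid \<Rightarrow> ('g \<Rightarrow> complex) set" where
  "B_star G = {F. \<exists>f :: nat \<Rightarrow> 'g \<Rightarrow> complex.
     (\<forall>n. f n \<in> B_c G) \<and>
     (\<forall>e>0. \<exists>N. \<forall>m\<ge>N. \<forall>n\<ge>N. red_norm G (\<lambda>\<gamma>. f m \<gamma> - f n \<gamma>) < e) \<and>
     (\<forall>\<gamma>. (\<lambda>n. f n \<gamma>) \<longlonglongrightarrow> F \<gamma>)}"

definition linear_subspace :: "('g \<Rightarrow> complex) set \<Rightarrow> bool" where
  "linear_subspace A \<longleftrightarrow>
     (\<lambda>\<gamma>. 0) \<in> A \<and>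
     (\<forall>f\<in>A. \<forall>g\<in>A. (\<lambda>\<gamma>. f \<gamma> + g \<gamma>) \<in> A) \<and>
     (\<forall>c. \<forall>f\<in>A. (\<lambda>\<gamma>. c * f \<gamma>) \<in> A)"

definition norm_closed_in ::
  "'g top_groupoid \<Rightarrow> ('g \<Rightarrow> complex) set \<Rightarrow> ('g \<Rightarrow> complex) set \<Rightarrow> bool" where
  "norm_closed_in G B A \<longleftrightarrow>
     A \<subseteq> B \<and>
     (\<forall>f F. (\<forall>n::nat. f n \<in> A) \<and> F \<in> B \<and> (\<lambda>n. red_norm G (\<lambda>\<gamma>. f n \<gamma> - F \<gamma>)) \<longlonglongrightarrow> 0
        \<longrightarrow> F \<in> A)"

definition C_star_subalgebra :: "'g top_groupoid \<Rightarrow> ('g \<Rightarrow> complex) set \<Rightarrow> bool" where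
  "C_star_subalgebra G A \<longleftrightarrow>
     linear_subspace A \<and>
     (\<forall>f\<in>A. \<forall>g\<in>A. conv G f g \<in> A) \<and>
     (\<forall>f\<in>A. adj G f \<in> A) \<and>
     norm_closed_in G (B_star G) A"

definition C_star :: "'g top_groupoid \<Rightarrow> ('g \<Rightarrow> complex) set" where
  "C_star G = {F \<in> B_star G. \<forall>A. C_star_subalgebra G A \<and> C_c G \<subseteq> A \<longrightarrow> F \<in> A}"

definition one_fun :: "'g top_groupoid \<Rightarrow> 'g \<Rightarrow> complex" where
  "one_fun G \<gamma> = (if \<gamma> \<in> units G then 1 else 0)"

definition projection_in :: "'g top_groupoid \<Rightarrow> ('g \<Rightarrow> complex) \<Rightarrow> bool" where
  "projection_in G p \<longleftrightarrow> p \<in> C_star G \<and> conv G p p = p \<and> adj G p = p"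

definition closed_ideal :: "'g top_groupoid \<Rightarrow> ('g \<Rightarrow> complex) set \<Rightarrow> bool" where
  "closed_ideal G J \<longleftrightarrow>
     linear_subspace J \<and>
     (\<forall>a\<in>C_star G. \<forall>f\<in>J. conv G a f \<in> J \<and> conv G f a \<in> J) \<and>
     norm_closed_in G (C_star G) J"

definition generated_closed_ideal ::
  "'g top_groupoid \<Rightarrow> ('g \<Rightarrow> complex) \<Rightarrow> ('g \<Rightarrow> complex) set" where
  "generated_closed_ideal G p = {a \<in> C_star G. \<forall>J. closed_ideal G J \<and> p \<in> J \<longrightarrow> a \<in> J}"

definition full_projection :: "'g top_groupoid \<Rightarrow> ('g \<Rightarrow> complex) \<Rightarrow> bool" where
  "full_projection G p \<longleftrightarrow> projection_in G p \<and> generated_closed_ideal G p = C_star G"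


section \<open>The groupoids of a locally injective map\<close>

definition locally_injective :: "('a::topological_space \<Rightarrow> 'b) \<Rightarrow> bool" where
  "locally_injective \<phi> \<longleftrightarrow> (\<forall>x. \<exists>U. open U \<and> x \<in> U \<and> inj_on \<phi> U)"

definition Gamma_set :: "('a \<Rightarrow> 'a) \<Rightarrow> ('a \<times> int \<times> 'a) set" where
  "Gamma_set \<phi> = {(x, k, y). \<exists>a b :: nat. k = int a - int b \<and> (\<phi> ^^ a) x = (\<phi> ^^ b) y}"

text \<open>Only used for \<open>n + k \<ge> 0\<close>, where the exponent \<open>k + i\<close> is not negative.\<close>

definition Gamma_level :: "('a \<Rightarrow> 'a) \<Rightarrow> int \<Rightarrow> nat \<Rightarrow> ('a \<times> int \<times> 'a) set" where
  "Gamma_level \<phi> k n =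
     {(x, j, y). j = k \<and> (\<forall>i\<ge>n. (\<phi> ^^ nat (k + int i)) x = (\<phi> ^^ i) y)}"

text \<open>The disjoint union over \<open>k\<close> of the inductive limits of the sets \<open>\<Gamma>(k,n)\<close>, each of these
  carrying the relative topology of \<open>X \<times> \<int> \<times> X\<close>.\<close>

definition Gamma_open :: "('a::topological_space \<Rightarrow> 'a) \<Rightarrow> ('a \<times> int \<times> 'a) set \<Rightarrow> bool" where
  "Gamma_open \<phi> U \<longleftrightarrow>
     U \<subseteq> Gamma_set \<phi> \<and>
     (\<forall>k n. int n + k \<ge> 0 \<longrightarrow>
        openin (top_of_set (Gamma_level \<phi> k n)) (U \<inter> Gamma_level \<phi> k n))"

definition Gamma_top :: "('a::topological_space \<Rightarrow> 'a) \<Rightarrow> ('a \<times> int \<times> 'a) topology" where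
  "Gamma_top \<phi> = topology (Gamma_open \<phi>)"

definition triple_mult :: "'a \<times> int \<times> 'a \<Rightarrow> 'a \<times> int \<times> 'a \<Rightarrow> 'a \<times> int \<times> 'a" where
  "triple_mult = (\<lambda>(x, k, y) (y', k', z). (x, k + k', z))"

definition triple_inv :: "'a \<times> int \<times> 'a \<Rightarrow> 'a \<times> int \<times> 'a" where
  "triple_inv = (\<lambda>(x, k, y). (y, - k, x))"

definition Gamma_phi :: "('a::topological_space \<Rightarrow> 'a) \<Rightarrow> ('a \<times> int \<times> 'a) top_groupoid" where
  "Gamma_phi \<phi> = \<lparr>gtop = Gamma_top \<phi>, gmult = triple_mult, ginv = triple_inv\<rparr>"

text \<open>The pair \<open>(x, y)\<close> in \<open>R\<close> is represented by the triple \<open>(x, 0, y)\<close>.\<close>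

definition R_phi :: "('a::topological_space \<Rightarrow> 'a) \<Rightarrow> ('a \<times> int \<times> 'a) top_groupoid" where
  "R_phi \<phi> = \<lparr>gtop = subtopology (Gamma_top \<phi>) {(x, k, y). k = 0},
               gmult = triple_mult, ginv = triple_inv\<rparr>"

lemma istopology_Gamma_open: "istopology (Gamma_open \<phi>)"
  unfolding istopology_def
proof (intro conjI allI impI)
  fix S T assume S: "Gamma_open \<phi> S" and T: "Gamma_open \<phi> T"
  show "Gamma_open \<phi> (S \<inter> T)"
    unfolding Gamma_open_def
  proof (intro conjI allI impI)
    show "S \<inter> T \<subseteq> Gamma_set \<phi>"
      using S unfolding Gamma_open_def by blast
    fix k n assume kn: "int n + k \<ge> 0"
    let ?L = "Gamma_level \<phi> k n"
    have "openin (top_of_set ?L) (S \<inter> ?L)" "openin (top_of_set ?L) (T \<inter> ?L)"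
      using S T kn unfolding Gamma_open_def by blast+
    then have "openin (top_of_set ?L) ((S \<inter> ?L) \<inter> (T \<inter> ?L))"
      by (rule openin_Int)
    moreover have "(S \<inter> ?L) \<inter> (T \<inter> ?L) = S \<inter> T \<inter> ?L" by blast
    ultimately show "openin (top_of_set ?L) (S \<inter> T \<inter> ?L)" by (rule back_subst)
  qed
next
  fix K assume K: "\<forall>S\<in>K. Gamma_open \<phi> S"
  show "Gamma_open \<phi> (\<Union>K)"
    unfolding Gamma_open_def
  proof (intro conjI allI impI)
    show "\<Union>K \<subseteq> Gamma_set \<phi>"
      using K unfolding Gamma_open_def by blast
    fix k n assume kn: "int n + k \<ge> 0"
    let ?L = "Gamma_level \<phi> k n"
    have "openin (top_of_set ?L) (\<Union>S\<in>K. S \<inter> ?L)"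
      using K kn unfolding Gamma_open_def by (intro openin_Union) blast
    moreover have "(\<Union>S\<in>K. S \<inter> ?L) = \<Union>K \<inter> ?L" by blast
    ultimately show "openin (top_of_set ?L) (\<Union>K \<inter> ?L)" by (rule back_subst)
  qed
qed

lemma openin_Gamma_top: "openin (Gamma_top \<phi>) U \<longleftrightarrow> Gamma_open \<phi> U"
  unfolding Gamma_top_def topology_inverse'[OF istopology_Gamma_open] ..

lemma Gamma_level_subset:
  assumes "int n + k \<ge> 0"
  shows "Gamma_level \<phi> k n \<subseteq> Gamma_set \<phi>"
proof
  fix g assume "g \<in> Gamma_level \<phi> k n"
  then obtain x y where g: "g = (x, k, y)" and xy: "(\<phi> ^^ nat (k + int n)) x = (\<phi> ^^ n) y"
    unfolding Gamma_level_def by blast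
  have "k = int (nat (k + int n)) - int n" using assms by simp
  with xy show "g \<in> Gamma_set \<phi>" unfolding Gamma_set_def g by blast
qed

lemma Gamma_set_eq_Union: "Gamma_set \<phi> = (\<Union>k. \<Union>n\<in>{n. int n + k \<ge> 0}. Gamma_level \<phi> k n)"
proof
  show "Gamma_set \<phi> \<subseteq> (\<Union>k. \<Union>n\<in>{n. int n + k \<ge> 0}. Gamma_level \<phi> k n)"
  proof
    fix g assume "g \<in> Gamma_set \<phi>"
    then obtain x y a b where g: "g = (x, int a - int b, y)" and ab: "(\<phi> ^^ a) x = (\<phi> ^^ b) y"
      unfolding Gamma_set_def by auto
    have "(\<phi> ^^ nat (int a - int b + int i)) x = (\<phi> ^^ i) y" if "i \<ge> b" for i
    proof -
      have "nat (int a - int b + int i) = (i - b) + a" and "i = (i - b) + b"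
        using that by auto
      then have "(\<phi> ^^ nat (int a - int b + int i)) x = (\<phi> ^^ (i - b)) ((\<phi> ^^ a) x)"
        and "(\<phi> ^^ i) y = (\<phi> ^^ (i - b)) ((\<phi> ^^ b) y)"
        by (simp only: funpow_add comp_apply, metis funpow_add comp_apply)
      with ab show ?thesis by simp
    qed
    then have "g \<in> Gamma_level \<phi> (int a - int b) b"
      unfolding Gamma_level_def g by simp
    then show "g \<in> (\<Union>k. \<Union>n\<in>{n. int n + k \<ge> 0}. Gamma_level \<phi> k n)"
      by (intro UN_I[of "int a - int b"] UN_I[of b]) simp_all
  qed
next
  show "(\<Union>k. \<Union>n\<in>{n. int n + k \<ge> 0}. Gamma_level \<phi> k n) \<subseteq> Gamma_set \<phi>"
    by (intro UN_least Gamma_level_subset) simp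
qed

lemma topspace_Gamma_top: "topspace (Gamma_top \<phi>) = Gamma_set \<phi>"
proof
  show "topspace (Gamma_top \<phi>) \<subseteq> Gamma_set \<phi>"
    unfolding topspace_def openin_Gamma_top Gamma_open_def by blast
  have "Gamma_set \<phi> \<inter> Gamma_level \<phi> k n = Gamma_level \<phi> k n" if "int n + k \<ge> 0" for k n
    using Gamma_level_subset[OF that] by blast
  then have "Gamma_open \<phi> (Gamma_set \<phi>)"
    unfolding Gamma_open_def by simp
  then show "Gamma_set \<phi> \<subseteq> topspace (Gamma_top \<phi>)"
    by (simp add: openin_Gamma_top openin_subset)
qed


section \<open>The endomorphism and the isometry\<close>

definition mult_fun :: "('a \<Rightarrow> 'a) \<Rightarrow> 'a \<Rightarrow> nat" where
  "mult_fun \<phi> x = card {y. \<phi> y = \<phi> x}"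

text \<open>The defining formula on the functions in \<open>C\<^sup>*\<^sub>r(R(\<phi>\<^sup>k))\<close> does not depend on \<open>k\<close>. Since
  norm convergence implies pointwise convergence, it also describes the continuous extension to
  all of \<open>C\<^sup>*\<^sub>r(R\<^sub>\<phi>)\<close>.\<close>

definition phi_hat ::
  "('a::topological_space \<Rightarrow> 'a) \<Rightarrow> ('a \<times> int \<times> 'a \<Rightarrow> complex) \<Rightarrow> 'a \<times> int \<times> 'a \<Rightarrow> complex" where
  "phi_hat \<phi> f = (\<lambda>(x, k, y).
     if (x, k, y) \<in> arrows (R_phi \<phi>)
     then complex_of_real (1 / sqrt (real (mult_fun \<phi> x)) * (1 / sqrt (real (mult_fun \<phi> y))))
            * f (\<phi> x, 0, \<phi> y)
     else 0)"

definition iso_v :: "('a \<Rightarrow> 'a) \<Rightarrow> 'a \<times> int \<times> 'a \<Rightarrow> complex" where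
  "iso_v \<phi> = (\<lambda>(x, k, y).
     if k = 1 \<and> y = \<phi> x then complex_of_real (1 / sqrt (real (mult_fun \<phi> x))) else 0)"

end

theory Submission
  imports Defs "HOL-Computational_Algebra.Polynomial"
begin

text \<open>Let \<open>u\<close> be the indicator function of the compact open set \<open>R(\<phi>)\<close>. Then \<open>u \<star> u = m u\<close>, and \<open>m\<close> is
  bounded and constant on the classes of \<open>R(\<phi>)\<close>, so \<open>p = vv\<^sup>*\<close>, which is \<open>m\<^sup>-\<^sup>1 u\<close>, is a linear
  combination of the powers of \<open>u\<close>. Conversely \<open>u = u \<star> p\<close> lies in the ideal generated by \<open>p\<close>.
  If \<open>\<phi>\<close> is injective where the continuous function \<open>h\<close> on \<open>X\<close> does not vanish, then
  \<open>h \<star> u \<star> h\<close> is supported on the diagonal, where it is \<open>h\<^sup>2\<close>. Finitely many such \<open>h\<close> have no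
  common zero, and dividing by \<open>g = \<Sum>h\<^sup>2\<close> gives \<open>1 = \<Sum>(h/g) \<star> u \<star> h\<close>. Hence the algebraic ideal
  generated by \<open>p\<close> already contains the unit.\<close>

section \<open>The tail equivalence relation and convolution over it\<close>

lemma Gamma_set_zero_iff: "(x, 0, y) \<in> Gamma_set \<phi> \<longleftrightarrow> (\<exists>n. (\<phi> ^^ n) x = (\<phi> ^^ n) y)"
  unfolding Gamma_set_def by auto

lemma funpow_eq_mono:
  fixes \<phi> :: "'a \<Rightarrow> 'a"
  assumes "(\<phi> ^^ m) x = (\<phi> ^^ m) y" "m \<le> n"
  shows "(\<phi> ^^ n) x = (\<phi> ^^ n) y"
proof -
  have "(\<phi> ^^ n) z = (\<phi> ^^ (n - m)) ((\<phi> ^^ m) z)" for z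
    using assms(2) by (metis comp_apply funpow_add le_add_diff_inverse2)
  then show ?thesis using assms(1) by simp
qed

text \<open>Once two iterates agree, all later ones do, so the condition for all
  \<open>i \<ge> n\<close> collapses to the one at \<open>n\<close>.\<close>

lemma Gamma_level_zero_iff:
  "(x, k, y) \<in> Gamma_level \<phi> 0 n \<longleftrightarrow> k = 0 \<and> (\<phi> ^^ n) x = (\<phi> ^^ n) y"
  unfolding Gamma_level_def by (auto intro: funpow_eq_mono)

lemma Gamma_set_zero_trans:
  assumes "(x, 0, y) \<in> Gamma_set \<phi>" "(y, 0, z) \<in> Gamma_set \<phi>"
  shows "(x, 0, z) \<in> Gamma_set \<phi>"
proof -
  obtain m n where "(\<phi> ^^ m) x = (\<phi> ^^ m) y" "(\<phi> ^^ n) y = (\<phi> ^^ n) z"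
    using assms unfolding Gamma_set_zero_iff by blast
  then have "(\<phi> ^^ (m + n)) x = (\<phi> ^^ (m + n)) z"
    by (metis funpow_eq_mono le_add1 le_add2)
  then show ?thesis unfolding Gamma_set_zero_iff by blast
qed

lemma Gamma_set_zero_sym: "(x, 0, y) \<in> Gamma_set \<phi> \<Longrightarrow> (y, 0, x) \<in> Gamma_set \<phi>"
  unfolding Gamma_set_zero_iff by metis

lemma Gamma_level_zero_subset: "Gamma_level \<phi> 0 n \<subseteq> Gamma_set \<phi>"
  by (rule Gamma_level_subset) simp

lemma arrows_R_phi: "(x, k, y) \<in> arrows (R_phi \<phi>) \<longleftrightarrow> k = 0 \<and> (x, 0, y) \<in> Gamma_set \<phi>"
  unfolding arrows_def R_phi_def by (auto simp: topspace_Gamma_top)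

lemma Gamma_level_subset_arrows: "Gamma_level \<phi> 0 n \<subseteq> arrows (R_phi \<phi>)"
proof
  fix \<gamma> assume g: "\<gamma> \<in> Gamma_level \<phi> 0 n"
  obtain x k y where "\<gamma> = (x, k, y)" by (cases \<gamma>)
  with g show "\<gamma> \<in> arrows (R_phi \<phi>)"
    using Gamma_level_zero_subset by (fastforce simp: Gamma_level_zero_iff arrows_R_phi)
qed

lemma src_R_phi: "src (R_phi \<phi>) (x, k, y) = (y, 0, y)"
  by (simp add: src_def R_phi_def triple_mult_def triple_inv_def)

lemma rng_R_phi: "rng (R_phi \<phi>) (x, k, y) = (x, 0, x)"
  by (simp add: rng_def R_phi_def triple_mult_def triple_inv_def)

lemma gmult_R_phi: "gmult (R_phi \<phi>) (x, k, y) (y', k', z) = (x, k + k', z)"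
  by (simp add: R_phi_def triple_mult_def)

lemma refl_in_Gamma_set: "(x, 0, x) \<in> Gamma_set \<phi>"
  by (simp add: Gamma_set_zero_iff)

lemma units_R_phi: "(x, k, y) \<in> units (R_phi \<phi>) \<longleftrightarrow> k = 0 \<and> x = y"
proof
  assume "(x, k, y) \<in> units (R_phi \<phi>)"
  then show "k = 0 \<and> x = y" unfolding units_def by (auto simp: src_R_phi)
next
  assume "k = 0 \<and> x = y"
  then show "(x, k, y) \<in> units (R_phi \<phi>)"
    unfolding units_def
    by (auto simp: src_R_phi arrows_R_phi refl_in_Gamma_set intro!: image_eqI[of _ _ "(x, 0, x)"])
qed

text \<open>A factorization of \<open>(x, 0, y)\<close> is determined by its middle point, so
  convolution is matrix multiplication over the tail class of \<open>x\<close>. A triple that is not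
  an arrow has no factorization, by transitivity.\<close>

lemma conv_R_phi:
  "conv (R_phi \<phi>) f g (x, k, y) =
     (if (x, k, y) \<in> arrows (R_phi \<phi>)
      then \<Sum>\<^sub>\<infinity>z\<in>{z. (x, 0, z) \<in> Gamma_set \<phi>}. f (x, 0, z) * g (z, 0, y) else 0)"
proof (cases "(x, k, y) \<in> arrows (R_phi \<phi>)")
  case True
  then have k: "k = 0" and xy: "(x, 0, y) \<in> Gamma_set \<phi>" by (auto simp: arrows_R_phi)
  have "bij_betw (\<lambda>z. ((x, 0, z), (z, 0, y))) {z. (x, 0, z) \<in> Gamma_set \<phi>}
          (factorizations (R_phi \<phi>) (x, k, y))"
    unfolding bij_betw_def
  proof
    show "inj_on (\<lambda>z. ((x, 0, z), (z, 0, y))) {z. (x, 0, z) \<in> Gamma_set \<phi>}"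
      by (auto intro: inj_onI)
    show "(\<lambda>z. ((x, 0, z), (z, 0, y))) ` {z. (x, 0, z) \<in> Gamma_set \<phi>}
            = factorizations (R_phi \<phi>) (x, k, y)"
      using k Gamma_set_zero_trans[OF Gamma_set_zero_sym xy]
      by (auto simp: factorizations_def arrows_R_phi src_R_phi rng_R_phi gmult_R_phi)
  qed
  from infsum_reindex_bij_betw[OF this, of "\<lambda>(\<gamma>1, \<gamma>2). f \<gamma>1 * g \<gamma>2"] True
  show ?thesis by (simp add: conv_def)
next
  case False
  have "factorizations (R_phi \<phi>) (x, k, y) = {}"
    using False
    by (auto simp: factorizations_def arrows_R_phi src_R_phi rng_R_phi gmult_R_phi
        dest: Gamma_set_zero_trans)
  then show ?thesis using False by (simp add: conv_def)
qed

section \<open>Diagonal functions and functions of the fibre cardinality\<close>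

definition diag_fun :: "('a \<Rightarrow> complex) \<Rightarrow> 'a \<times> int \<times> 'a \<Rightarrow> complex" where
  "diag_fun a = (\<lambda>(x, k, y). if k = 0 \<and> x = y then a x else 0)"

text \<open>The coefficient depends only on the fibre cardinality. This family contains both
  \<open>u\<close> and \<open>p\<close> and is closed under convolution, which turns identities
  between such functions into arithmetic in \<open>n\<close>.\<close>

definition fibre_fun :: "('a \<Rightarrow> 'a) \<Rightarrow> (nat \<Rightarrow> complex) \<Rightarrow> 'a \<times> int \<times> 'a \<Rightarrow> complex" where
  "fibre_fun \<phi> c = (\<lambda>(x, k, y). if k = 0 \<and> \<phi> x = \<phi> y then c (mult_fun \<phi> x) else 0)"

lemma one_fun_R_phi: "one_fun (R_phi \<phi>) = diag_fun (\<lambda>_. 1)"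
  by (auto simp: fun_eq_iff one_fun_def diag_fun_def units_R_phi)

text \<open>Only the middle point \<open>z = x\<close> contributes. The hypothesis on
  \<open>f\<close> makes the equation hold off the arrows too, where a convolution is 0.\<close>

lemma conv_diag_left:
  assumes "\<And>\<gamma>. \<gamma> \<notin> arrows (R_phi \<phi>) \<Longrightarrow> f \<gamma> = 0"
  shows "conv (R_phi \<phi>) (diag_fun a) f (x, k, y) = a x * f (x, k, y)"
proof (cases "(x, k, y) \<in> arrows (R_phi \<phi>)")
  case True
  have "(\<Sum>\<^sub>\<infinity>z\<in>{z. (x, 0, z) \<in> Gamma_set \<phi>}. diag_fun a (x, 0, z) * f (z, 0, y))
      = (\<Sum>\<^sub>\<infinity>z\<in>{x}. diag_fun a (x, 0, z) * f (z, 0, y))"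
    by (rule infsum_cong_neutral) (auto simp: diag_fun_def refl_in_Gamma_set)
  then show ?thesis using True by (simp add: conv_R_phi diag_fun_def arrows_R_phi)
qed (simp add: conv_R_phi assms)

lemma conv_diag_right:
  assumes "\<And>\<gamma>. \<gamma> \<notin> arrows (R_phi \<phi>) \<Longrightarrow> f \<gamma> = 0"
  shows "conv (R_phi \<phi>) f (diag_fun a) (x, k, y) = f (x, k, y) * a y"
proof (cases "(x, k, y) \<in> arrows (R_phi \<phi>)")
  case True
  then have "(x, 0, y) \<in> Gamma_set \<phi>" by (simp add: arrows_R_phi)
  then have "(\<Sum>\<^sub>\<infinity>z\<in>{z. (x, 0, z) \<in> Gamma_set \<phi>}. f (x, 0, z) * diag_fun a (z, 0, y))
      = (\<Sum>\<^sub>\<infinity>z\<in>{y}. f (x, 0, z) * diag_fun a (z, 0, y))"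
    by (intro infsum_cong_neutral) (auto simp: diag_fun_def)
  then show ?thesis using True by (simp add: conv_R_phi diag_fun_def arrows_R_phi)
qed (simp add: conv_R_phi assms)

lemma fibre_in_Gamma_set: "\<phi> x = \<phi> y \<Longrightarrow> (x, 0, y) \<in> Gamma_set \<phi>"
  unfolding Gamma_set_zero_iff by (rule exI[of _ 1]) simp

lemma fibre_fun_off_arrows: "\<gamma> \<notin> arrows (R_phi \<phi>) \<Longrightarrow> fibre_fun \<phi> c \<gamma> = 0"
  by (cases \<gamma>) (auto simp: fibre_fun_def arrows_R_phi fibre_in_Gamma_set)

text \<open>Only middle points in the fibre of \<open>x\<close> contribute, and
  \<open>mult_fun \<phi>\<close> is constant on that fibre. The sum therefore has
  \<open>mult_fun \<phi> x\<close> equal terms, which is the factor \<open>of_nat n\<close>.\<close>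

lemma conv_fibre_fun:
  assumes fin: "\<And>x. finite {z. \<phi> z = \<phi> x}"
  shows "conv (R_phi \<phi>) (fibre_fun \<phi> c) (fibre_fun \<phi> d)
           = fibre_fun \<phi> (\<lambda>n. of_nat n * (c n * d n))"
proof
  fix \<gamma> :: "'a \<times> int \<times> 'a"
  obtain x k y where g: "\<gamma> = (x, k, y)" by (cases \<gamma>)
  have m: "mult_fun \<phi> z = mult_fun \<phi> x" if "\<phi> z = \<phi> x" for z
    using that by (simp add: mult_fun_def)
  show "conv (R_phi \<phi>) (fibre_fun \<phi> c) (fibre_fun \<phi> d) \<gamma>
          = fibre_fun \<phi> (\<lambda>n. of_nat n * (c n * d n)) \<gamma>"
  proof (cases "\<gamma> \<in> arrows (R_phi \<phi>)")
    case True
    have "conv (R_phi \<phi>) (fibre_fun \<phi> c) (fibre_fun \<phi> d) \<gamma> =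
      (\<Sum>\<^sub>\<infinity>z\<in>{z. (x, 0, z) \<in> Gamma_set \<phi>}. fibre_fun \<phi> c (x, 0, z) * fibre_fun \<phi> d (z, 0, y))"
      using True by (simp add: g conv_R_phi)
    also have "\<dots> = (\<Sum>\<^sub>\<infinity>z\<in>{z. \<phi> z = \<phi> x}. fibre_fun \<phi> c (x, 0, z) * fibre_fun \<phi> d (z, 0, y))"
      by (rule infsum_cong_neutral)
         (auto simp: fibre_fun_def fibre_in_Gamma_set split: if_splits)
    also have "\<dots> = (\<Sum>z\<in>{z. \<phi> z = \<phi> x}. fibre_fun \<phi> c (x, 0, z) * fibre_fun \<phi> d (z, 0, y))"
      using fin by simp
    also have "\<dots> = (\<Sum>z\<in>{z. \<phi> z = \<phi> x}.
        if \<phi> x = \<phi> y then c (mult_fun \<phi> x) * d (mult_fun \<phi> x) else 0)"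
    proof (rule sum.cong[OF refl])
      fix z assume "z \<in> {z. \<phi> z = \<phi> x}"
      then show "fibre_fun \<phi> c (x, 0, z) * fibre_fun \<phi> d (z, 0, y)
          = (if \<phi> x = \<phi> y then c (mult_fun \<phi> x) * d (mult_fun \<phi> x) else 0)"
        using m[of z] by (simp add: fibre_fun_def)
    qed
    also have "\<dots> = fibre_fun \<phi> (\<lambda>n. of_nat n * (c n * d n)) \<gamma>"
      using True by (simp add: g fibre_fun_def arrows_R_phi) (simp add: mult_fun_def)
    finally show ?thesis .
  next
    case False
    then show ?thesis using g by (simp add: conv_R_phi fibre_fun_off_arrows)
  qed
qed


section \<open>Topology of the groupoid of the tail equivalence relation\<close>

lemma locally_injective_funpow:
  fixes \<phi> :: "'a::topological_space \<Rightarrow> 'a"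
  assumes "continuous_on UNIV \<phi>" "locally_injective \<phi>"
  shows "locally_injective (\<phi> ^^ n)"
proof (induction n)
  case 0
  show ?case unfolding locally_injective_def by (auto intro: exI[of _ UNIV])
next
  case (Suc n)
  show ?case
    unfolding locally_injective_def
  proof
    fix x
    obtain U where U: "open U" "x \<in> U" "inj_on \<phi> U"
      using assms(2) unfolding locally_injective_def by blast
    obtain V where V: "open V" "\<phi> x \<in> V" "inj_on (\<phi> ^^ n) V"
      using Suc unfolding locally_injective_def by blast
    have "open (\<phi> -` V)" using assms(1) V(1) by (simp add: continuous_on_open_vimage)
    moreover have "inj_on (\<phi> ^^ Suc n) (U \<inter> \<phi> -` V)"
      using U(3) V(3) by (auto simp: inj_on_def funpow_Suc_right simp del: funpow.simps)
    ultimately show "\<exists>U. open U \<and> x \<in> U \<and> inj_on (\<phi> ^^ Suc n) U"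
      using U V by (intro exI[of _ "U \<inter> \<phi> -` V"]) auto
  qed
qed

lemma continuous_on_funpow:
  fixes \<phi> :: "'a::topological_space \<Rightarrow> 'a"
  assumes "continuous_on UNIV \<phi>"
  shows "continuous_on UNIV (\<phi> ^^ n)"
proof (induction n)
  case (Suc n)
  then have "continuous_on UNIV (\<phi> \<circ> \<phi> ^^ n)"
    by (rule continuous_on_compose) (rule continuous_on_subset[OF assms], simp)
  then show ?case by simp
qed (simp add: id_def)

text \<open>The inductive limit topology is at least as fine as the one inherited from the product,
  because \<open>W\<close> cuts every level in a relatively open set.\<close>

lemma openin_R_phi_Int:
  assumes "open W"
  shows "openin (gtop (R_phi \<phi>)) (W \<inter> arrows (R_phi \<phi>))"
proof -
  have "Gamma_open \<phi> (W \<inter> Gamma_set \<phi>)"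
    unfolding Gamma_open_def
  proof (intro conjI allI impI)
    fix k n assume "int n + k \<ge> 0"
    then have "W \<inter> Gamma_set \<phi> \<inter> Gamma_level \<phi> k n = Gamma_level \<phi> k n \<inter> W"
      using Gamma_level_subset by blast
    then show "openin (top_of_set (Gamma_level \<phi> k n)) (W \<inter> Gamma_set \<phi> \<inter> Gamma_level \<phi> k n)"
      using assms by (simp add: openin_open_Int)
  qed simp
  then show ?thesis
    unfolding R_phi_def arrows_def
    by (auto simp: openin_subtopology openin_Gamma_top topspace_Gamma_top)
qed

text \<open>This is where local injectivity enters the topology: near an arrow with
  \<open>(\<phi> ^^ n) x = (\<phi> ^^ n) y\<close>, agreement of the later iterates
  \<open>\<phi> ^^ N\<close> forces agreement already at \<open>n\<close>.\<close>

lemma openin_R_phi_level: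
  fixes \<phi> :: "'a::t2_space \<Rightarrow> 'a"
  assumes "continuous_on UNIV \<phi>" "locally_injective \<phi>"
  shows "openin (gtop (R_phi \<phi>)) (Gamma_level \<phi> 0 n)"
proof -
  have "Gamma_open \<phi> (Gamma_level \<phi> 0 n)"
    unfolding Gamma_open_def
  proof (intro conjI allI impI)
    show "Gamma_level \<phi> 0 n \<subseteq> Gamma_set \<phi>" by (rule Gamma_level_zero_subset)
    fix k N assume "int N + k \<ge> 0"
    show "openin (top_of_set (Gamma_level \<phi> k N)) (Gamma_level \<phi> 0 n \<inter> Gamma_level \<phi> k N)"
    proof (cases "k = 0")
      case False
      then have "Gamma_level \<phi> 0 n \<inter> Gamma_level \<phi> k N = {}"
        by (auto simp: Gamma_level_def)
      then show ?thesis by simp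
    next
      case True
      show ?thesis
      proof (rule openin_subopen[THEN iffD2], intro ballI)
        fix \<gamma> assume g: "\<gamma> \<in> Gamma_level \<phi> 0 n \<inter> Gamma_level \<phi> k N"
        obtain x y where \<gamma>: "\<gamma> = (x, 0, y)" and xy: "(\<phi> ^^ n) x = (\<phi> ^^ n) y"
          using g by (cases \<gamma>) (auto simp: Gamma_level_zero_iff)
        \<comment> \<open>The difference \<open>N - n\<close> is truncated: for
          \<open>N \<le> n\<close> the exponent is 0, and that case is settled below by monotonicity
          instead.\<close>
        obtain U where U: "open U" "(\<phi> ^^ n) x \<in> U" "inj_on (\<phi> ^^ (N - n)) U"
          using locally_injective_funpow[OF assms] unfolding locally_injective_def by blast
        define V where "V = (\<phi> ^^ n) -` U"
        have V: "open V" unfolding V_def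
          using continuous_on_funpow[OF assms(1)] U(1) by (simp add: continuous_on_open_vimage)
        let ?W = "V \<times> (UNIV :: int set) \<times> V"
        have "Gamma_level \<phi> k N \<inter> ?W \<subseteq> Gamma_level \<phi> 0 n"
        proof
          fix \<delta> assume d: "\<delta> \<in> Gamma_level \<phi> k N \<inter> ?W"
          obtain x' y' where \<delta>: "\<delta> = (x', 0, y')" and e: "(\<phi> ^^ N) x' = (\<phi> ^^ N) y'"
            using d True by (cases \<delta>) (auto simp: Gamma_level_zero_iff)
          have v: "(\<phi> ^^ n) x' \<in> U" "(\<phi> ^^ n) y' \<in> U" using d \<delta> by (auto simp: V_def)
          have "(\<phi> ^^ n) x' = (\<phi> ^^ n) y'"
          proof (cases "N \<le> n")
            case True
            then show ?thesis using e funpow_eq_mono by metis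
          next
            case False
            then have "(\<phi> ^^ N) z = (\<phi> ^^ (N - n)) ((\<phi> ^^ n) z)" for z
              by (metis comp_apply funpow_add le_add_diff_inverse2 nat_le_linear)
            then show ?thesis using e v U(3) by (simp add: inj_on_eq_iff)
          qed
          then show "\<delta> \<in> Gamma_level \<phi> 0 n" by (simp add: \<delta> Gamma_level_zero_iff)
        qed
        moreover have "openin (top_of_set (Gamma_level \<phi> k N)) (Gamma_level \<phi> k N \<inter> ?W)"
          using V by (intro openin_open_Int open_Times) auto
        moreover have "\<gamma> \<in> Gamma_level \<phi> k N \<inter> ?W"
          using g xy U(2) by (simp add: \<gamma> V_def)
        ultimately show "\<exists>T. openin (top_of_set (Gamma_level \<phi> k N)) T \<and> \<gamma> \<in> T \<and>
            T \<subseteq> Gamma_level \<phi> 0 n \<inter> Gamma_level \<phi> k N"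
          by blast
      qed
    qed
  qed
  moreover have "Gamma_level \<phi> 0 n \<subseteq> {(x, k, y). k = 0}"
    by (auto simp: Gamma_level_def)
  ultimately show ?thesis
    unfolding R_phi_def by (auto simp: openin_subtopology openin_Gamma_top)
qed

text \<open>Two continuous maps into a Hausdorff space agree on a closed set.\<close>

lemma closed_Gamma_level:
  fixes \<phi> :: "'a::t2_space \<Rightarrow> 'a"
  assumes "continuous_on UNIV \<phi>"
  shows "closed (Gamma_level \<phi> 0 n)"
proof -
  have c: "continuous_on UNIV (\<lambda>\<gamma>::'a \<times> int \<times> 'a. (\<phi> ^^ n) (f \<gamma>))"
    if "continuous_on UNIV f" for f
    by (rule continuous_on_compose2[OF continuous_on_funpow[OF assms] that]) simp
  have "Gamma_level \<phi> 0 n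
      = {\<gamma>. fst (snd \<gamma>) = 0} \<inter> {\<gamma>. (\<phi> ^^ n) (fst \<gamma>) = (\<phi> ^^ n) (snd (snd \<gamma>))}"
    by (auto simp: Gamma_level_zero_iff)
  then show ?thesis
    by (auto intro!: closed_Int closed_Collect_eq continuous_intros c)
qed

lemma closedin_R_phi_level:
  fixes \<phi> :: "'a::t2_space \<Rightarrow> 'a"
  assumes "continuous_on UNIV \<phi>"
  shows "closedin (gtop (R_phi \<phi>)) (Gamma_level \<phi> 0 n)"
proof -
  have "openin (gtop (R_phi \<phi>)) (- Gamma_level \<phi> 0 n \<inter> arrows (R_phi \<phi>))"
    by (rule openin_R_phi_Int) (use closed_Gamma_level[OF assms] in auto)
  moreover have "- Gamma_level \<phi> 0 n \<inter> arrows (R_phi \<phi>) = topspace (gtop (R_phi \<phi>)) - Gamma_level \<phi> 0 n"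
    by (auto simp: arrows_def)
  ultimately show ?thesis
    using Gamma_level_subset_arrows[of \<phi> n] by (simp add: closedin_def arrows_def)
qed

text \<open>The level is closed in the compact space X x {0} x X. By definition of the inductive
  limit topology its inclusion is continuous, so compactness carries over to
  \<open>R_phi\<close>.\<close>

lemma compactin_R_phi_level:
  fixes \<phi> :: "'a::t2_space \<Rightarrow> 'a"
  assumes "compact (UNIV :: 'a set)" "continuous_on UNIV \<phi>"
  shows "compactin (gtop (R_phi \<phi>)) (Gamma_level \<phi> 0 n)"
proof -
  let ?L = "Gamma_level \<phi> 0 n"
  have "compact ((UNIV :: 'a set) \<times> {0 :: int} \<times> (UNIV :: 'a set))"
    using assms(1) by (intro compact_Times) auto
  then have "compact (((UNIV :: 'a set) \<times> {0 :: int} \<times> (UNIV :: 'a set)) \<inter> ?L)"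
    by (rule compact_Int_closed) (rule closed_Gamma_level[OF assms(2)])
  moreover have "((UNIV :: 'a set) \<times> {0 :: int} \<times> (UNIV :: 'a set)) \<inter> ?L = ?L"
    by (auto simp: Gamma_level_zero_iff)
  ultimately have "compactin (top_of_set ?L) ?L"
    by (simp add: compactin_subtopology)
  moreover have "continuous_map (top_of_set ?L) (gtop (R_phi \<phi>)) id"
  proof -
    have "continuous_map (top_of_set ?L) (Gamma_top \<phi>) id"
      unfolding continuous_map_def
    proof (intro conjI allI impI)
      show "id \<in> topspace (top_of_set ?L) \<rightarrow> topspace (Gamma_top \<phi>)"
        using Gamma_level_zero_subset[of \<phi> n] by (auto simp: topspace_Gamma_top)
      fix U assume "openin (Gamma_top \<phi>) U"
      then have "openin (top_of_set ?L) (U \<inter> ?L)"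
        by (simp add: openin_Gamma_top Gamma_open_def)
      moreover have "U \<inter> ?L = {x \<in> topspace (top_of_set ?L). id x \<in> U}" by auto
      ultimately show "openin (top_of_set ?L) {x \<in> topspace (top_of_set ?L). id x \<in> U}" by simp
    qed
    then show ?thesis
      unfolding R_phi_def by (auto simp: continuous_map_in_subtopology Gamma_level_zero_iff)
  qed
  ultimately show ?thesis
    using image_compactin by fastforce
qed

lemma compactly_supported_level:
  fixes \<phi> :: "'a::t2_space \<Rightarrow> 'a"
  assumes "compact (UNIV :: 'a set)" "continuous_on UNIV \<phi>"
    and f: "\<And>\<gamma>. \<gamma> \<notin> Gamma_level \<phi> 0 n \<Longrightarrow> f \<gamma> = 0"
  shows "compactly_supported (R_phi \<phi>) f"
  unfolding compactly_supported_def
proof (intro conjI allI impI)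
  fix \<gamma> assume "\<gamma> \<notin> arrows (R_phi \<phi>)"
  then show "f \<gamma> = 0" using f Gamma_level_subset_arrows by blast
next
  let ?S = "{\<gamma> \<in> arrows (R_phi \<phi>). f \<gamma> \<noteq> 0}"
  have "gtop (R_phi \<phi>) closure_of ?S \<subseteq> Gamma_level \<phi> 0 n"
    by (rule closure_of_minimal[OF _ closedin_R_phi_level[OF assms(2)]]) (use f in blast)
  then show "compactin (gtop (R_phi \<phi>)) (gtop (R_phi \<phi>) closure_of ?S)"
    by (rule closed_compactin[OF compactin_R_phi_level[OF assms(1,2)]]) simp
qed

text \<open>The level is open and closed, so cutting off to 0 outside it preserves continuity, and
  its compactness gives compact support.\<close>

lemma level_fun_in_C_c:
  fixes \<phi> :: "'a::t2_space \<Rightarrow> 'a"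
  assumes "compact (UNIV :: 'a set)" "continuous_on UNIV \<phi>" "locally_injective \<phi>"
    and h: "continuous_on UNIV h"
  shows "(\<lambda>\<gamma>. if \<gamma> \<in> Gamma_level \<phi> 0 n then h (fst \<gamma>) else 0) \<in> C_c (R_phi \<phi>)" (is "?f \<in> _")
proof -
  let ?T = "gtop (R_phi \<phi>)" and ?L = "Gamma_level \<phi> 0 n"
  have "continuous_map ?T euclidean ?f"
    unfolding continuous_map_def
  proof (intro conjI allI impI)
    fix U :: "complex set" assume "openin euclidean U"
    then have U: "open U" by simp
    have hU: "open ((h -` U) \<times> (UNIV :: (int \<times> 'a) set))"
      using h U by (intro open_Times) (auto simp: continuous_on_open_vimage)
    have 1: "openin ?T (?L \<inter> ((h -` U) \<times> UNIV \<inter> arrows (R_phi \<phi>)))"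
      by (intro openin_Int openin_R_phi_level openin_R_phi_Int hU assms)
    have 2: "openin ?T (topspace ?T - ?L)"
      by (intro openin_diff closedin_R_phi_level assms) simp
    have "{\<gamma> \<in> topspace ?T. ?f \<gamma> \<in> U} = ?L \<inter> ((h -` U) \<times> UNIV \<inter> arrows (R_phi \<phi>))
        \<union> (if 0 \<in> U then topspace ?T - ?L else {})"
      by (auto simp: arrows_def)
    then show "openin ?T {\<gamma> \<in> topspace ?T. ?f \<gamma> \<in> U}" using 1 2 by auto
  qed auto
  then show ?thesis
    unfolding C_c_def using compactly_supported_level[OF assms(1,2), of n ?f] by simp
qed

lemma fibre_fun_one_in_C_c:
  fixes \<phi> :: "'a::t2_space \<Rightarrow> 'a"
  assumes "compact (UNIV :: 'a set)" "continuous_on UNIV \<phi>" "locally_injective \<phi>"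
  shows "fibre_fun \<phi> (\<lambda>_. 1) \<in> C_c (R_phi \<phi>)"
proof -
  have "fibre_fun \<phi> (\<lambda>_. 1) = (\<lambda>\<gamma>. if \<gamma> \<in> Gamma_level \<phi> 0 1 then (\<lambda>_. 1) (fst \<gamma>) else 0)"
    by (auto simp: fun_eq_iff fibre_fun_def Gamma_level_zero_iff)
  also have "\<dots> \<in> C_c (R_phi \<phi>)" by (intro level_fun_in_C_c assms) simp
  finally show ?thesis .
qed

lemma diag_fun_in_C_c:
  fixes \<phi> :: "'a::t2_space \<Rightarrow> 'a"
  assumes "compact (UNIV :: 'a set)" "continuous_on UNIV \<phi>" "locally_injective \<phi>"
    and "continuous_on UNIV a"
  shows "diag_fun a \<in> C_c (R_phi \<phi>)"
proof -
  have "diag_fun a = (\<lambda>\<gamma>. if \<gamma> \<in> Gamma_level \<phi> 0 0 then a (fst \<gamma>) else 0)"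
    by (auto simp: fun_eq_iff diag_fun_def Gamma_level_zero_iff)
  also have "\<dots> \<in> C_c (R_phi \<phi>)" by (intro level_fun_in_C_c assms)
  finally show ?thesis .
qed


section \<open>Membership in the groupoid algebras\<close>

text \<open>This makes constant sequences Cauchy in \<open>B_star\<close>. Arrows must exist because
  the real supremum over an empty set of units has no specified value.\<close>

lemma red_norm_zero:
  assumes "arrows G \<noteq> {}"
  shows "red_norm G (\<lambda>_. 0) = 0"
proof -
  have "reg_rep_norm G x (\<lambda>_. 0) = 0" for x
  proof -
    have "reg_rep G x (\<lambda>_. 0) \<psi> = (\<lambda>_. 0)" for \<psi>
      by (auto simp: fun_eq_iff reg_rep_def intro!: infsum_0)
    moreover have "(\<lambda>_. 0) \<in> {\<psi> \<in> l2_space (src_fibre G x). l2_norm (src_fibre G x) \<psi> \<le> 1}"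
      by (simp add: l2_space_def l2_norm_def)
    then have "{\<psi> \<in> l2_space (src_fibre G x). l2_norm (src_fibre G x) \<psi> \<le> 1} \<noteq> {}" by blast
    ultimately show ?thesis unfolding reg_rep_norm_def by (simp add: l2_norm_def)
  qed
  moreover have "units G \<noteq> {}" using assms by (simp add: units_def)
  ultimately show ?thesis unfolding red_norm_def by simp
qed

lemma B_c_subset_B_star:
  assumes "arrows G \<noteq> {}"
  shows "B_c G \<subseteq> B_star G"
proof
  fix f assume "f \<in> B_c G"
  then show "f \<in> B_star G"
    unfolding B_star_def by (auto simp: red_norm_zero[OF assms] intro!: exI[of _ "\<lambda>_. f"])
qed

text \<open>The values on the compact closure of the support form a bounded set, and every other
  value is 0.\<close>

lemma C_c_subset_B_c: "C_c G \<subseteq> B_c G"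
proof
  fix f assume "f \<in> C_c G"
  then have cs: "compactly_supported G f" and cont: "continuous_map (gtop G) euclidean f"
    by (auto simp: C_c_def)
  let ?S = "{\<gamma> \<in> arrows G. f \<gamma> \<noteq> 0}"
  have "compactin euclidean (f ` (gtop G closure_of ?S))"
    using image_compactin[OF _ cont] cs by (simp add: compactly_supported_def)
  then have "bounded (insert 0 (f ` (gtop G closure_of ?S)))"
    by (simp add: compact_imp_bounded)
  moreover have "?S \<subseteq> gtop G closure_of ?S"
    by (rule closure_of_subset) (auto simp: arrows_def)
  then have "f ` arrows G \<subseteq> insert 0 (f ` (gtop G closure_of ?S))" by blast
  ultimately have "bounded (f ` arrows G)" by (rule bounded_subset)
  then show "f \<in> B_c G" using cs by (simp add: B_c_def)
qed

lemma C_c_subset_C_star: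
  assumes "arrows G \<noteq> {}"
  shows "C_c G \<subseteq> C_star G"
  using C_c_subset_B_c B_c_subset_B_star[OF assms] unfolding C_star_def by blast

text \<open>Elements are pointwise limits of functions vanishing there. It supplies the hypothesis
  of \<open>conv_diag_right\<close> for an arbitrary element of the algebra.\<close>

lemma C_star_off_arrows:
  assumes "F \<in> C_star G" "\<gamma> \<notin> arrows G"
  shows "F \<gamma> = 0"
proof -
  obtain f where f: "\<And>n::nat. f n \<in> B_c G" and lim: "(\<lambda>n. f n \<gamma>) \<longlonglongrightarrow> F \<gamma>"
    using assms(1) unfolding C_star_def B_star_def by blast
  have "f n \<gamma> = 0" for n
    using f[of n] assms(2) by (simp add: B_c_def compactly_supported_def)
  then show ?thesis using lim by (simp add: LIMSEQ_const_iff)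
qed

lemma linear_subspace_sum:
  assumes "linear_subspace A" "finite I" "\<And>i. i \<in> I \<Longrightarrow> f i \<in> A"
  shows "(\<lambda>\<gamma>. \<Sum>i\<in>I. f i \<gamma>) \<in> A"
  using assms(2,3) by (induction I) (use assms(1) in \<open>auto simp: linear_subspace_def\<close>)

lemma interpolating_poly:
  fixes g :: "'b::field \<Rightarrow> 'b"
  assumes "finite S"
  shows "\<exists>q. \<forall>s\<in>S. poly q s = g s"
  using assms
proof (induction S)
  \<comment> \<open>The correction term is a multiple of \<open>w\<close>, which vanishes at the old
    nodes but not at the new one.\<close>
  case (insert s S)
  then obtain q where q: "\<forall>t\<in>S. poly q t = g t" by blast
  define w where "w = (\<Prod>t\<in>S. [:- t, 1:])"
  have w0: "poly w t = 0" if "t \<in> S" for t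
    using that insert.hyps by (auto simp: w_def poly_prod)
  have ws: "poly w s \<noteq> 0"
    using insert.hyps by (auto simp: w_def poly_prod)
  show ?case
    by (rule exI[of _ "q + smult ((g s - poly q s) / poly w s) w"]) (use q w0 ws in auto)
qed simp

text \<open>As \<open>fibre_fun \<phi> (\<lambda>_. 1)\<close> multiplies \<open>fibre_fun \<phi> c\<close> by the fibre cardinality, and as this
  takes finitely many values, interpolation makes up for the discontinuity of \<open>mult_fun \<phi>\<close>.\<close>

lemma fibre_fun_in_C_star:
  fixes \<phi> :: "'a::t2_space \<Rightarrow> 'a"
  assumes X: "compact (UNIV :: 'a set)" "continuous_on UNIV \<phi>" "locally_injective \<phi>"
    and fin: "\<And>x. finite {z. \<phi> z = \<phi> x}" and N: "\<And>x. mult_fun \<phi> x \<le> N"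
  shows "fibre_fun \<phi> c \<in> C_star (R_phi \<phi>)"
proof -
  \<comment> \<open>\<open>C_star\<close> is carved out of \<open>B_star\<close>, so membership
    there comes first: a bounded function supported in the compact level 1 lies in
    \<open>B_c\<close>, even where \<open>mult_fun \<phi>\<close> jumps.\<close>
  have "bounded (insert 0 (c ` {..N}))" by (intro finite_imp_bounded) simp
  moreover have "fibre_fun \<phi> c ` arrows (R_phi \<phi>) \<subseteq> insert 0 (c ` {..N})"
    using N by (auto simp: fibre_fun_def)
  ultimately have "bounded (fibre_fun \<phi> c ` arrows (R_phi \<phi>))" by (rule bounded_subset)
  moreover have "compactly_supported (R_phi \<phi>) (fibre_fun \<phi> c)"
    by (rule compactly_supported_level[OF X(1,2), of 1])
       (auto simp: fibre_fun_def Gamma_level_zero_iff)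
  ultimately have "fibre_fun \<phi> c \<in> B_c (R_phi \<phi>)" by (simp add: B_c_def)
  moreover have "arrows (R_phi \<phi>) \<noteq> {}"
    using arrows_R_phi refl_in_Gamma_set by (metis empty_iff)
  ultimately have B: "fibre_fun \<phi> c \<in> B_star (R_phi \<phi>)"
    using B_c_subset_B_star subsetD by metis
  have "fibre_fun \<phi> c \<in> A"
    if A: "C_star_subalgebra (R_phi \<phi>) A" and sub: "C_c (R_phi \<phi>) \<subseteq> A" for A
  proof -
    have lin: "linear_subspace A" and mul: "\<And>f g. f \<in> A \<Longrightarrow> g \<in> A \<Longrightarrow> conv (R_phi \<phi>) f g \<in> A"
      using A by (auto simp: C_star_subalgebra_def)
    have one: "fibre_fun \<phi> (\<lambda>_. 1) \<in> A" using fibre_fun_one_in_C_c[OF X] sub by blast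
    \<comment> \<open>The constant polynomial 1 corresponds to \<open>u\<close>, and convolving with
      \<open>u\<close> multiplies the coefficient by \<open>n\<close>. Thus
      \<open>pCons a q\<close>, with value \<open>a + n * q(n)\<close>, is reached by one
      convolution and one addition.\<close>
    have P: "fibre_fun \<phi> (\<lambda>n. poly q (of_nat n)) \<in> A" for q
    proof (induction q)
      case 0
      have "fibre_fun \<phi> (\<lambda>n. poly 0 (of_nat n)) = (\<lambda>_. 0)" by (auto simp: fibre_fun_def)
      then show ?case using lin by (simp add: linear_subspace_def)
    next
      case (pCons a q)
      have "(\<lambda>\<gamma>. a * fibre_fun \<phi> (\<lambda>_. 1) \<gamma>) \<in> A"
        using lin one by (simp add: linear_subspace_def)
      moreover have "fibre_fun \<phi> (\<lambda>n. of_nat n * (poly q (of_nat n) * 1)) \<in> A"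
        using mul[OF pCons.IH one] by (simp only: conv_fibre_fun[OF fin])
      ultimately have "(\<lambda>\<gamma>. a * fibre_fun \<phi> (\<lambda>_. 1) \<gamma>
          + fibre_fun \<phi> (\<lambda>n. of_nat n * (poly q (of_nat n) * 1)) \<gamma>) \<in> A"
        using lin by (simp add: linear_subspace_def)
      moreover have "(\<lambda>\<gamma>. a * fibre_fun \<phi> (\<lambda>_. 1) \<gamma>
          + fibre_fun \<phi> (\<lambda>n. of_nat n * (poly q (of_nat n) * 1)) \<gamma>)
          = fibre_fun \<phi> (\<lambda>n. poly (pCons a q) (of_nat n))"
        by (auto simp: fibre_fun_def)
      ultimately show ?case by simp
    qed
    \<comment> \<open>The nodes are the possible cardinalities as complex numbers;
      \<open>of_nat\<close> is injective there, so the description recovers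
      \<open>n\<close>.\<close>
    obtain q where q: "\<forall>s \<in> of_nat ` {..N}. poly q s = c (THE n. of_nat n = s)"
      using interpolating_poly[of "of_nat ` {..N}" "\<lambda>s. c (THE n. of_nat n = s)"] by fast
    have "poly q (of_nat n) = c n" if "n \<le> N" for n
      using q that by simp
    then have "fibre_fun \<phi> (\<lambda>n. poly q (of_nat n)) = fibre_fun \<phi> c"
      using N by (auto simp: fun_eq_iff fibre_fun_def)
    then show ?thesis using P by metis
  qed
  then show ?thesis using B by (simp add: C_star_def)
qed

section \<open>Bump functions and bounds on the fibres\<close>

lemma finite_bump_family:
  fixes \<phi> :: "'a::t2_space \<Rightarrow> 'a"
  assumes X: "compact (UNIV :: 'a set)" and met: "metrizable_space (euclidean :: 'a topology)"
    and inj: "locally_injective \<phi>"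
  obtains H :: "('a \<Rightarrow> real) set" where "finite H" "\<And>h. h \<in> H \<Longrightarrow> continuous_on UNIV h"
    "\<And>h. h \<in> H \<Longrightarrow> inj_on \<phi> {x. h x \<noteq> 0}" "\<And>x. \<exists>h\<in>H. h x \<noteq> 0"
proof -
  have ex: "\<exists>h :: 'a \<Rightarrow> real. continuous_on UNIV h \<and> inj_on \<phi> {y. h y \<noteq> 0} \<and> h x \<noteq> 0" for x
  proof -
    obtain U where U: "open U" "x \<in> U" "inj_on \<phi> U"
      using inj unfolding locally_injective_def by blast
    have "completely_regular_space (euclidean :: 'a topology)"
      using met by (rule metrizable_imp_completely_regular_space)
    then obtain f :: "'a \<Rightarrow> real" where f: "continuous_map euclidean (top_of_set {0..1}) f"
      "f x = 0" "f ` (- U) \<subseteq> {1}"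
      using U unfolding completely_regular_space_def
      by (metis Compl_eq_Diff_UNIV DiffI Diff_iff UNIV_I closed_Compl closed_closedin topspace_euclidean double_complement)
    have "continuous_on UNIV f" using f(1) by (simp add: continuous_map_in_subtopology)
    \<comment> \<open>Complete regularity gave \<open>f\<close> equal to 0 at \<open>x\<close> and 1
      off \<open>U\<close>; hence \<open>1 - f\<close> is the bump, nonzero only inside
      \<open>U\<close>.\<close>
    then have "continuous_on UNIV (\<lambda>y. 1 - f y)" by (intro continuous_intros)
    moreover have "{y. 1 - f y \<noteq> 0} \<subseteq> U" using f(3) by auto
    ultimately show ?thesis
      using f(2) U(3) by (intro exI[of _ "\<lambda>y. 1 - f y"]) (auto intro: inj_on_subset)
  qed
  then obtain h :: "'a \<Rightarrow> 'a \<Rightarrow> real" where h: "\<And>x. continuous_on UNIV (h x)"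
    "\<And>x. inj_on \<phi> {y. h x y \<noteq> 0}" "\<And>x. h x x \<noteq> 0" by metis
  \<comment> \<open>These sets cover the space, since \<open>x\<close> lies in its own; a finite
    subcover leaves finitely many functions without a common zero.\<close>
  have "open {y. h x y \<noteq> 0}" for x
    by (intro open_Collect_neq h(1) continuous_intros)
  then obtain D where "D \<subseteq> UNIV" "finite D" "UNIV \<subseteq> (\<Union>x\<in>D. {y. h x y \<noteq> 0})"
    by (rule compactE_image[OF X, of UNIV "\<lambda>x. {y. h x y \<noteq> 0}"]) (use h(3) in blast)+
  then show ?thesis
    by (intro that[of "h ` D"]) (use h in auto)
qed

text \<open>Each point of a fibre chooses a function in \<open>H\<close> not vanishing there. Two
  points of one fibre cannot choose the same function, as \<open>\<phi>\<close> is injective where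
  it is nonzero; so the fibre embeds in \<open>H\<close>.\<close>

lemma finite_fibres:
  assumes "finite H" "\<And>h. h \<in> H \<Longrightarrow> inj_on \<phi> {x. h x \<noteq> (0::real)}" "\<And>x. \<exists>h\<in>H. h x \<noteq> 0"
  shows "finite {z. \<phi> z = \<phi> x}" "mult_fun \<phi> x \<le> card H"
proof -
  obtain c where c: "\<And>z. c z \<in> H \<and> c z z \<noteq> 0" using assms(3) by metis
  have "inj_on c {z. \<phi> z = \<phi> x}"
  proof (rule inj_onI)
    fix z w assume "z \<in> {z. \<phi> z = \<phi> x}" "w \<in> {z. \<phi> z = \<phi> x}" "c z = c w"
    then show "z = w"
      using c[of z] c[of w] assms(2)[of "c z"] by (auto simp: inj_on_def)
  qed
  moreover have "c ` {z. \<phi> z = \<phi> x} \<subseteq> H" using c by blast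
  ultimately show "finite {z. \<phi> z = \<phi> x}" "mult_fun \<phi> x \<le> card H"
    using assms(1) by (auto simp: mult_fun_def intro: inj_on_finite card_inj_on_le)
qed

section \<open>Two descriptions of the projection\<close>

lemma phi_hat_one:
  "phi_hat \<phi> (one_fun (R_phi \<phi>)) = fibre_fun \<phi> (\<lambda>n. 1 / of_nat n)"
proof
  fix \<gamma> :: "'a \<times> int \<times> 'a"
  obtain x k y where g: "\<gamma> = (x, k, y)" by (cases \<gamma>)
  \<comment> \<open>The entry is nonzero only if \<open>\<phi> x = \<phi> y\<close>; then both
    square roots are those of the same cardinality and multiply to its inverse.\<close>
  have "complex_of_real (1 / sqrt (real m) * (1 / sqrt (real m))) = 1 / of_nat m" for m
    by simp
  moreover have "mult_fun \<phi> y = mult_fun \<phi> x" if "\<phi> x = \<phi> y"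
    using that by (simp add: mult_fun_def)
  ultimately show "phi_hat \<phi> (one_fun (R_phi \<phi>)) \<gamma> = fibre_fun \<phi> (\<lambda>n. 1 / of_nat n) \<gamma>"
    by (auto simp: g phi_hat_def one_fun_R_phi diag_fun_def fibre_fun_def arrows_R_phi
        fibre_in_Gamma_set simp del: of_real_mult of_real_divide)
qed

text \<open>A nonzero contribution needs the factors \<open>(x, 1, \<phi> x)\<close> and
  \<open>(\<phi> y, - 1, y)\<close>. These compose only if \<open>\<phi> x = \<phi> y\<close>, their
  degrees cancel, and the sum has at most one nonzero term.\<close>

lemma conv_iso_v_adj:
  "conv (Gamma_phi \<phi>) (iso_v \<phi>) (adj (Gamma_phi \<phi>) (iso_v \<phi>)) = fibre_fun \<phi> (\<lambda>n. 1 / of_nat n)"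
proof
  fix \<gamma> :: "'a \<times> int \<times> 'a"
  obtain x k y where g: "\<gamma> = (x, k, y)" by (cases \<gamma>)
  let ?G = "Gamma_phi \<phi>" and ?p = "\<lambda>(\<gamma>1, \<gamma>2). iso_v \<phi> \<gamma>1 * adj (Gamma_phi \<phi>) (iso_v \<phi>) \<gamma>2"
  have arr: "arrows ?G = Gamma_set \<phi>" by (simp add: arrows_def Gamma_phi_def topspace_Gamma_top)
  have src: "src ?G (a, j, b) = (b, 0, b)" and rng: "rng ?G (a, j, b) = (a, 0, a)"
    and mul: "gmult ?G (a, j, b) (b', j', c) = (a, j + j', c)"
    and inv: "ginv ?G (a, j, b) = (b, - j, a)" for a b b' c j j'
    by (simp_all add: src_def rng_def Gamma_phi_def triple_mult_def triple_inv_def)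
  have v1: "(x, 1, \<phi> x) \<in> Gamma_set \<phi>"
  proof -
    have "1 = int 1 - int 0 \<and> (\<phi> ^^ 1) x = (\<phi> ^^ 0) (\<phi> x)" by simp
    then show ?thesis unfolding Gamma_set_def by blast
  qed
  have v2: "(\<phi> x, - 1, y) \<in> Gamma_set \<phi>" if "\<phi> x = \<phi> y"
  proof -
    have "- 1 = int 0 - int 1 \<and> (\<phi> ^^ 0) (\<phi> x) = (\<phi> ^^ 1) y" using that by simp
    then show ?thesis unfolding Gamma_set_def by blast
  qed
  show "conv ?G (iso_v \<phi>) (adj ?G (iso_v \<phi>)) \<gamma> = fibre_fun \<phi> (\<lambda>n. 1 / of_nat n) \<gamma>"
  proof (cases "k = 0 \<and> \<phi> x = \<phi> y")
    case True
    have m: "mult_fun \<phi> y = mult_fun \<phi> x" using True by (simp add: mult_fun_def)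
    have mem: "((x, 1, \<phi> x), (\<phi> x, - 1, y)) \<in> factorizations ?G \<gamma>"
      using True v1 v2 by (simp add: factorizations_def arr src rng mul g)
    \<comment> \<open>The first factor already decides: where \<open>v\<close> is nonzero it is
      \<open>(x, 1, \<phi> x)\<close>, and the product \<open>\<gamma>\<close> then fixes the
      second.\<close>
    have zero: "?p \<delta> = 0"
      if "\<delta> \<in> factorizations ?G \<gamma>" "\<delta> \<noteq> ((x, 1, \<phi> x), (\<phi> x, - 1, y))" for \<delta>
    proof -
      obtain a j b b' j' c where d: "\<delta> = ((a, j, b), (b', j', c))" by (metis prod.exhaust)
      show ?thesis
        using that True by (auto simp: d g factorizations_def src rng mul iso_v_def)
    qed
    have "conv ?G (iso_v \<phi>) (adj ?G (iso_v \<phi>)) \<gamma> = infsum ?p {((x, 1, \<phi> x), (\<phi> x, - 1, y))}"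
      unfolding conv_def by (rule infsum_cong_neutral) (use mem zero in auto)
    also have "\<dots> = complex_of_real (1 / sqrt (real (mult_fun \<phi> x)) * (1 / sqrt (real (mult_fun \<phi> x))))"
      using True v2 by (simp add: iso_v_def adj_def arr inv m flip: of_real_mult)
    also have "\<dots> = 1 / of_nat (mult_fun \<phi> x)"
      by simp
    finally show ?thesis using True by (simp add: g fibre_fun_def)
  next
    case False
    have "?p \<delta> = 0" if "\<delta> \<in> factorizations ?G \<gamma>" for \<delta>
    proof -
      obtain a j b b' j' c where d: "\<delta> = ((a, j, b), (b', j', c))" by (metis prod.exhaust)
      show ?thesis
        using that False by (auto simp: d g factorizations_def src rng mul inv iso_v_def adj_def)
    qed
    then have "conv ?G (iso_v \<phi>) (adj ?G (iso_v \<phi>)) \<gamma> = 0"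
      unfolding conv_def by (rule infsum_0)
    then show ?thesis using False by (auto simp: g fibre_fun_def)
  qed
qed

lemma adj_fibre_fun:
  assumes "\<And>n. cnj (c n) = c n"
  shows "adj (R_phi \<phi>) (fibre_fun \<phi> c) = fibre_fun \<phi> c"
proof
  fix \<gamma> :: "'a \<times> int \<times> 'a"
  obtain x k y where g: "\<gamma> = (x, k, y)" by (cases \<gamma>)
  have "ginv (R_phi \<phi>) \<gamma> = (y, - k, x)" by (simp add: g R_phi_def triple_inv_def)
  moreover have "mult_fun \<phi> y = mult_fun \<phi> x" if "\<phi> x = \<phi> y"
    using that by (simp add: mult_fun_def)
  ultimately show "adj (R_phi \<phi>) (fibre_fun \<phi> c) \<gamma> = fibre_fun \<phi> c \<gamma>"
    using fibre_fun_off_arrows[of \<gamma> \<phi> c] assms by (auto simp: adj_def g fibre_fun_def)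
qed

section \<open>Fullness of the projection\<close>

theorem lemma4p7:
  fixes \<phi> :: "'a::t2_space \<Rightarrow> 'a"
  assumes "compact (UNIV :: 'a set)"
    and "metrizable_space (euclidean :: 'a topology)"
    and "continuous_on UNIV \<phi>"
    and "locally_injective \<phi>"
    and "surj \<phi>"
  shows "phi_hat \<phi> (one_fun (R_phi \<phi>)) = conv (Gamma_phi \<phi>) (iso_v \<phi>) (adj (Gamma_phi \<phi>) (iso_v \<phi>)) \<and>
         full_projection (R_phi \<phi>) (phi_hat \<phi> (one_fun (R_phi \<phi>)))"
proof -
  note X = assms(1,3,4)
  let ?G = "R_phi \<phi>" and ?p = "fibre_fun \<phi> (\<lambda>n. 1 / of_nat n)" and ?u = "fibre_fun \<phi> (\<lambda>_. 1)"
  obtain H :: "('a \<Rightarrow> real) set" where H: "finite H" "\<And>h. h \<in> H \<Longrightarrow> continuous_on UNIV h"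
    "\<And>h. h \<in> H \<Longrightarrow> inj_on \<phi> {x. h x \<noteq> 0}" "\<And>x. \<exists>h\<in>H. h x \<noteq> 0"
    using finite_bump_family[OF assms(1,2,4)] by blast
  note fin = finite_fibres(1)[OF H(1,3,4)] and N = finite_fibres(2)[OF H(1,3,4)]
  have pos: "mult_fun \<phi> x \<noteq> 0" for x
    using fin[of x] by (auto simp: mult_fun_def card_eq_0_iff)
  \<comment> \<open>No fibre is empty, so coefficients at 0 may be ignored; there
    \<open>1 / of_nat n\<close> is 0 and cancellation would fail.\<close>
  have eqI: "fibre_fun \<phi> c = fibre_fun \<phi> d" if "\<And>n. n \<noteq> 0 \<Longrightarrow> c n = d n" for c d
    using that pos by (auto simp: fun_eq_iff fibre_fun_def)
  have ne: "arrows ?G \<noteq> {}"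
    using arrows_R_phi refl_in_Gamma_set by (metis empty_iff)
  have proj: "projection_in ?G ?p"
  proof -
    have "conv ?G ?p ?p = fibre_fun \<phi> (\<lambda>n. of_nat n * (1 / of_nat n * (1 / of_nat n)))"
      by (rule conv_fibre_fun[OF fin])
    also have "\<dots> = ?p" by (rule eqI) simp
    finally have "conv ?G ?p ?p = ?p" .
    moreover have "adj ?G ?p = ?p" by (rule adj_fibre_fun) simp
    ultimately show ?thesis
      using fibre_fun_in_C_star[OF X fin N] by (simp add: projection_in_def)
  qed
  have "a \<in> J" if a: "a \<in> C_star ?G" and J: "closed_ideal ?G J" and pJ: "?p \<in> J" for a J
  proof -
    have lin: "linear_subspace J"
      and id: "\<And>f g. f \<in> C_star ?G \<Longrightarrow> g \<in> J \<Longrightarrow> conv ?G f g \<in> J \<and> conv ?G g f \<in> J"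
      using J by (auto simp: closed_ideal_def)
    \<comment> \<open>Recover \<open>u\<close> from \<open>p\<close>: the coefficient is
      \<open>n * (1 / n) = 1\<close>.\<close>
    have "conv ?G ?u ?p = fibre_fun \<phi> (\<lambda>n. of_nat n * (1 * (1 / of_nat n)))"
      by (rule conv_fibre_fun[OF fin])
    also have "\<dots> = ?u" by (rule eqI) simp
    finally have "conv ?G ?u ?p = ?u" .
    then have uJ: "?u \<in> J"
      using id[OF fibre_fun_in_C_star[OF X fin N] pJ] by metis
    define g where "g x = (\<Sum>h\<in>H. (h x)\<^sup>2)" for x
    have g0: "g x \<noteq> 0" for x
      using H(1,4) by (auto simp: g_def sum_nonneg_eq_0_iff)
    have gc: "continuous_on UNIV g"
      unfolding g_def by (intro continuous_intros H(2))
    define t where "t h = conv ?G (diag_fun (\<lambda>x. complex_of_real (h x / g x)))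
        (conv ?G ?u (diag_fun (\<lambda>x. complex_of_real (h x))))" for h
    have t: "t h (x, k, y) = complex_of_real (h x / g x) * (?u (x, k, y) * complex_of_real (h y))"
      for h x k y
    proof -
      \<comment> \<open>The outer product with a diagonal function can be evaluated once the inner
        convolution is known to vanish off the arrows.\<close>
      have "conv ?G ?u b \<gamma> = 0" if "\<gamma> \<notin> arrows ?G" for b \<gamma>
        using that by (cases \<gamma>) (simp add: conv_R_phi)
      then show ?thesis
        unfolding t_def
        by (simp add: conv_diag_left conv_diag_right[where f = ?u, OF fibre_fun_off_arrows])
    qed
    have tJ: "t h \<in> J" if h: "h \<in> H" for h
    proof -
      have "continuous_on UNIV (\<lambda>x. complex_of_real (h x))"
        "continuous_on UNIV (\<lambda>x. complex_of_real (h x / g x))"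
        using H(2)[OF h] gc g0 by (auto intro!: continuous_intros)
      then have "diag_fun (\<lambda>x. complex_of_real (h x)) \<in> C_star ?G"
        "diag_fun (\<lambda>x. complex_of_real (h x / g x)) \<in> C_star ?G"
        using diag_fun_in_C_c[OF X] C_c_subset_C_star[OF ne] by blast+
      then show ?thesis unfolding t_def using id uJ by blast
    qed
    have "(\<lambda>\<gamma>. \<Sum>h\<in>H. t h \<gamma>) = diag_fun (\<lambda>_. 1)"
    proof
      fix \<gamma> :: "'a \<times> int \<times> 'a"
      obtain x k y where \<gamma>: "\<gamma> = (x, k, y)" by (cases \<gamma>)
      show "(\<Sum>h\<in>H. t h \<gamma>) = diag_fun (\<lambda>_. 1) \<gamma>"
      proof (cases "k = 0 \<and> x = y")
        case True
        then have "(\<Sum>h\<in>H. t h \<gamma>) = (\<Sum>h\<in>H. complex_of_real ((h x)\<^sup>2 / g x))"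
          by (intro sum.cong) (simp_all add: \<gamma> t fibre_fun_def power2_eq_square)
        also have "\<dots> = complex_of_real ((\<Sum>h\<in>H. (h x)\<^sup>2) / g x)"
          unfolding sum_divide_distrib of_real_sum ..
        also have "\<dots> = 1" using g0[of x] by (simp add: g_def)
        finally show ?thesis using True by (simp add: \<gamma> diag_fun_def)
      next
        case False
        \<comment> \<open>Either \<open>u\<close> vanishes at \<open>\<gamma>\<close>, or
          \<open>x\<close> and \<open>y\<close> are distinct points of one fibre, and then
          \<open>h\<close> cannot be nonzero at both.\<close>
        have "t h \<gamma> = 0" if "h \<in> H" for h
          using False H(3)[OF that] by (auto simp: \<gamma> t fibre_fun_def inj_on_def)
        then show ?thesis using False by (simp add: \<gamma> diag_fun_def)
      qed
    qed
    then have "diag_fun (\<lambda>_. 1) \<in> J"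
      using linear_subspace_sum[OF lin H(1), of t] tJ by simp
    \<comment> \<open>With the unit in \<open>J\<close>, every \<open>a\<close> is the product of
      itself with an element of \<open>J\<close>.\<close>
    then have "conv ?G a (diag_fun (\<lambda>_. 1)) \<in> J" using id a by blast
    moreover have "conv ?G a (diag_fun (\<lambda>_. 1)) = a"
      using conv_diag_right[where f = a, OF C_star_off_arrows[OF a]] by (auto simp: fun_eq_iff)
    ultimately show ?thesis by simp
  qed
  then have "generated_closed_ideal ?G ?p = C_star ?G"
    by (auto simp: generated_closed_ideal_def)
  then show ?thesis
    using proj by (simp add: full_projection_def phi_hat_one conv_iso_v_adj)
qed

end
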